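(* If $\mathcal M$ and $G\in\mathcal D_{(SL)}$ solve (i.e. form a minimizer of) the optimization problem $$\min_{(G,\mathcal M)}\ \mathrm{Trace}(\mathcal M\,\mathcal B(G))\quad\text{s.t.}\quad\sigma(S-GL)\subset\mathbb C^-,\quad\mathcal A(G)^T\mathcal M+\mathcal M\mathcal A(G)+\mathcal C=0,$$ then there exists a symmetric matrix $\mathcal W\in\mathbb R^{(n+\nu)\times(n+\nu)}$ such that the triplet $(\mathcal W,\mathcal M,G)$ solves the KKT system $$\begin{cases}\mathcal A(G)^T\mathcal M+\mathcal M\mathcal A(G)+\mathcal C=0,\\ \mathcal A(G)\mathcal W+\mathcal W\mathcal A(G)^T+\mathcal B(G)=0,\\ M_{12}^TB+M_{22}G-M_{12}^TW_{12}L^T-M_{22}W_{22}L^T=0.\end{cases}$$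
   Context: Let $A\in\mathbb R^{n\times n}$, $B\in\mathbb R^{n\times m}$, $C\in\mathbb R^{p\times n}$ be a minimal realization of a linear time-invariant system $\dot x=Ax+Bu$, $y=Cx$, with $A$ stable: $\sigma(A)\subset\mathbb C^-$ ($\sigma$ is the spectrum, $\mathbb C^-$ the open left half plane). Fix $S\in\mathbb R^{\nu\times\nu}$ and $L\in\mathbb R^{m\times\nu}$ with the pair $(L,S)$ observable and $\sigma(S)\cap\sigma(A)=\emptyset$, and let $\Pi\in\mathbb R^{n\times\nu}$ be the unique solution of the Sylvester equation $A\Pi+BL=\Pi S$. The variable is $G\in\mathbb R^{\nu\times m}$ and $\mathcal D_{(SL)}=\{G:\sigma(S-GL)\subset\mathbb C^-\}$. Define $$\mathcal A(G)=\begin{bmatrix}A&0\\ 0&S-GL\end{bmatrix},\quad\mathcal B(G)=\begin{bmatrix}B\\ G\end{bmatrix}\begin{bmatrix}B\\ G\end{bmatrix}^T,\quad\mathcal C=\begin{bmatrix}I\\ -\Pi^T\end{bmatrix}C^TC\begin{bmatrix}I&-\Pi\end{bmatrix}.$$ Symmetric $(n+\nu)\times(n+\nu)$ matrices are partitioned as $\mathcal W=\begin{bmatrix}W_{11}&W_{12}\\ W_{12}^T&W_{22}\end{bmatrix}$, $\mathcal M=\begin{bmatrix}M_{11}&M_{12}\\ M_{12}^T&M_{22}\end{bmatrix}$ with $W_{11},M_{11}\in\mathbb R^{n\times n}$ and $W_{22},M_{22}\in\mathbb R^{\nu\times\nu}$. *)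

theory Defs
  imports "HOL-Analysis.Analysis"
begin

text \<open>An \<open>r \<times> c\<close> matrix has type \<^typ>\<open>real^'c^'r\<close> (columns first). Block matrices are indexed
  by sum types: \<open>Inl\<close> is the first block, \<open>Inr\<close> the second.\<close>

definition spectrum :: "real^'n^'n \<Rightarrow> complex set" where
  "spectrum A = {z. \<not> invertible (mat z - map_matrix complex_of_real A)}"

definition stable :: "real^'n^'n \<Rightarrow> bool" where
  "stable A \<longleftrightarrow> spectrum A \<subseteq> {z. Re z < 0}"

text \<open>The transfer function \<open>C (sI - A)\<^sup>-\<^sup>1 B\<close>, meaningful for \<open>s\<close> outside the spectrum of \<open>A\<close>.\<close>

definition transfer_function ::
    "real^'n^'n \<Rightarrow> real^'m^'n \<Rightarrow> real^'n^'p \<Rightarrow> complex \<Rightarrow> complex^'m^'p" where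
  "transfer_function A B C s =
     map_matrix complex_of_real C ** matrix_inv (mat s - map_matrix complex_of_real A)
       ** map_matrix complex_of_real B"

definition same_transfer_function ::
    "real^'n^'n \<Rightarrow> real^'m^'n \<Rightarrow> real^'n^'p \<Rightarrow> real^'k^'k \<Rightarrow> real^'m^'k \<Rightarrow> real^'k^'p \<Rightarrow> bool" where
  "same_transfer_function A B C A' B' C' \<longleftrightarrow>
     (\<forall>s. s \<notin> spectrum A \<longrightarrow> s \<notin> spectrum A' \<longrightarrow>
        transfer_function A B C s = transfer_function A' B' C' s)"

text \<open>Types cannot be quantified, so a system whose state coordinates are indexed by \<open>I\<close>
  (state dimension \<open>card I\<close>) is stored on the full index type with all other entries zero.
  Every system of state dimension at most \<open>CARD('n)\<close> arises in this way for some \<open>I\<close>, including the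
  one of dimension \<open>0\<close>. For \<open>s \<noteq> 0\<close>, \<open>sI - A'\<close> is block diagonal with \<open>sI\<close> as the block
  outside \<open>I\<close>, so the padding does not change the transfer function; it can only add \<open>0\<close> to the
  spectrum, and two rational functions that agree off a finite set are equal.\<close>

definition has_states_in :: "'n set \<Rightarrow> real^'n^'n \<Rightarrow> real^'m^'n \<Rightarrow> real^'n^'p \<Rightarrow> bool" where
  "has_states_in I A B C \<longleftrightarrow>
     (\<forall>i j. i \<notin> I \<or> j \<notin> I \<longrightarrow> A $ i $ j = 0) \<and>
     (\<forall>i j. i \<notin> I \<longrightarrow> B $ i $ j = 0) \<and>
     (\<forall>i j. j \<notin> I \<longrightarrow> C $ i $ j = 0)"

text \<open>No system of smaller state dimension has the same transfer function.\<close>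

definition minimal_realization :: "real^'n^'n \<Rightarrow> real^'m^'n \<Rightarrow> real^'n^'p \<Rightarrow> bool" where
  "minimal_realization A B C \<longleftrightarrow>
     \<not> (\<exists>(I :: 'n set) A' B' C'. card I < CARD('n) \<and> has_states_in I A' B' C' \<and>
          same_transfer_function A B C A' B' C')"

primrec matpow :: "real^'n^'n \<Rightarrow> nat \<Rightarrow> real^'n^'n" where
  "matpow A 0 = mat 1"
| "matpow A (Suc k) = A ** matpow A k"

text \<open>The observability matrix with block rows \<open>L, LS, \<dots>, LS\<^bsup>\<nu>-1\<^esup>\<close> has rank \<open>\<nu>\<close>; its rank is the
  dimension of the span of all rows of its blocks.\<close>

definition observable_pair :: "real^'v^'m \<Rightarrow> real^'v^'v \<Rightarrow> bool" where
  "observable_pair L S \<longleftrightarrow> dim (\<Union>k<CARD('v). rows (L ** matpow S k)) = CARD('v)"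

definition block_diag :: "real^'n^'n \<Rightarrow> real^'v^'v
    \<Rightarrow> real^('n::finite + 'v::finite)^('n + 'v)" where
  "block_diag P Q = (\<chi> i j. case (i, j) of
       (Inl a, Inl b) \<Rightarrow> P $ a $ b
     | (Inr a, Inr b) \<Rightarrow> Q $ a $ b
     | _ \<Rightarrow> 0)"

definition vstack :: "real^'m^'n \<Rightarrow> real^'m^'v \<Rightarrow> real^'m^('n::finite + 'v::finite)" where
  "vstack P Q = (\<chi> i j. case i of Inl a \<Rightarrow> P $ a $ j | Inr a \<Rightarrow> Q $ a $ j)"

definition hstack :: "real^'n^'p \<Rightarrow> real^'v^'p \<Rightarrow> real^('n::finite + 'v::finite)^'p" where
  "hstack P Q = (\<chi> i j. case j of Inl b \<Rightarrow> P $ i $ b | Inr b \<Rightarrow> Q $ i $ b)"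

definition block12 :: "real^('n::finite + 'v::finite)^('n + 'v) \<Rightarrow> real^'v^'n" where
  "block12 M = (\<chi> i j. M $ Inl i $ Inr j)"

definition block22 :: "real^('n::finite + 'v::finite)^('n + 'v) \<Rightarrow> real^'v^'v" where
  "block22 M = (\<chi> i j. M $ Inr i $ Inr j)"

definition error_A :: "real^'n^'n \<Rightarrow> real^'v^'v \<Rightarrow> real^'v^'m \<Rightarrow> real^'m^'v
    \<Rightarrow> real^('n::finite + 'v::finite)^('n + 'v)" where
  "error_A A S L G = block_diag A (S - G ** L)"

definition error_B :: "real^'m^'n \<Rightarrow> real^'m^'v \<Rightarrow> real^('n::finite + 'v::finite)^('n + 'v)" where
  "error_B B G = vstack B G ** transpose (vstack B G)"

definition error_C :: "real^'n^'p \<Rightarrow> real^'v^'n \<Rightarrow> real^('n::finite + 'v::finite)^('n + 'v)" where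
  "error_C C P = vstack (mat 1) (- transpose P) ** (transpose C ** C) ** hstack (mat 1) (- P)"

text \<open>Constraints of the minimization problem; \<open>P\<close> is the solution of the Sylvester equation
  \<open>A ** P + B ** L = P ** S\<close>. The decision variable \<open>M\<close> ranges over symmetric matrices.\<close>

definition feasible :: "real^'n^'n \<Rightarrow> real^'n^'p \<Rightarrow> real^'v^'v \<Rightarrow> real^'v^'m \<Rightarrow> real^'v^'n
    \<Rightarrow> (real^'m^'v) \<times> (real^('n::finite + 'v::finite)^('n + 'v)) \<Rightarrow> bool" where
  "feasible A C S L P = (\<lambda>(G, M). transpose M = M \<and> stable (S - G ** L) \<and>
     transpose (error_A A S L G) ** M + M ** error_A A S L G + error_C C P = 0)"

end

theory Submission
  imports Defs "HOL-Computational_Algebra.Fundamental_Theorem_Algebra"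
begin

text \<open>Lagrange multipliers in the form of adjoint states. Since \<open>A\<close> and \<open>S - GL\<close> are stable, the
  Lyapunov operator of \<open>\<A>(G)\<close> is injective, hence bijective, and the Gramian \<open>\<W>\<close> exists. Stability
  is an open condition, so \<open>G\<close> can be moved to \<open>G + tZ\<close> for all small \<open>t\<close> of either sign, and
  minimality forces the derivative of the cost at \<open>t = 0\<close> to vanish. Expressed through \<open>\<W>\<close> this
  derivative is twice the trace of \<open>Z\<close> times the transpose of the third KKT residual; taking \<open>Z\<close> to
  be that residual makes it \<open>2 \<parallel>Z\<parallel>\<^sup>2\<close>, so \<open>Z = 0\<close>.\<close>

section \<open>Matrix algebra: bilinearity of the product, scalar matrices, transposes\<close>

lemma matrix_mult_zero_left [simp]: "(0 :: 'a::semiring_1^'n^'m) ** X = 0"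
  by (vector matrix_matrix_mult_def)

lemma matrix_mult_zero_right [simp]: "X ** (0 :: 'a::semiring_1^'n^'m) = 0"
  by (vector matrix_matrix_mult_def)

lemma matrix_mult_diff_left: "(X - Y) ** Z = X ** Z - Y ** (Z :: 'a::ring_1^'n^'m)"
  by (simp add: vec_eq_iff matrix_matrix_mult_def left_diff_distrib sum_subtractf)

lemma matrix_mult_diff_right: "Z ** (X - Y) = Z ** X - Z ** (Y :: 'a::ring_1^'n^'m)"
  by (simp add: vec_eq_iff matrix_matrix_mult_def right_diff_distrib sum_subtractf)

lemma matrix_mult_minus_left: "(- X) ** Y = - (X ** (Y :: 'a::ring_1^'n^'m))"
  by (simp add: vec_eq_iff matrix_matrix_mult_def sum_negf)

lemma matrix_mult_minus_right: "X ** (- Y) = - (X ** (Y :: 'a::ring_1^'n^'m))"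
  by (simp add: vec_eq_iff matrix_matrix_mult_def sum_negf)

lemma matrix_mult_scaleR_left: "(r *\<^sub>R X) ** Y = r *\<^sub>R (X ** (Y :: 'a::real_algebra_1^'n^'m))"
  by (simp add: vec_eq_iff matrix_matrix_mult_def scaleR_sum_right)

lemma matrix_mult_scaleR_right: "X ** (r *\<^sub>R Y) = r *\<^sub>R (X ** (Y :: 'a::real_algebra_1^'n^'m))"
  by (simp add: vec_eq_iff matrix_matrix_mult_def scaleR_sum_right)

lemma matrix_mult_add_left: "(X + Y) ** Z = X ** Z + Y ** (Z :: 'a::semiring_1^'n^'m)"
  by (simp add: vec_eq_iff matrix_matrix_mult_def distrib_right sum.distrib)

lemmas matrix_mult_distribs =
  matrix_add_ldistrib matrix_mult_add_left matrix_mult_diff_left matrix_mult_diff_right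
  matrix_mult_minus_left matrix_mult_minus_right matrix_mult_scaleR_left matrix_mult_scaleR_right

lemma mat_mult_nth: "(mat c ** X) $ i $ j = c * X $ i $ j"
  by (simp add: matrix_matrix_mult_def mat_def if_distrib if_distribR cong: if_cong)

lemma mult_mat_nth: "(X ** mat c) $ i $ j = X $ i $ j * c"
  by (simp add: matrix_matrix_mult_def mat_def if_distrib if_distribR cong: if_cong)

lemma mat_commute: "mat c ** X = X ** mat (c :: 'a::comm_semiring_1)"
  by (simp add: vec_eq_iff mat_mult_nth mult_mat_nth mult.commute)

lemma mat_add: "mat (a + b) = mat a + mat (b :: 'a::semiring_1)"
  by (simp add: vec_eq_iff mat_def)

lemma mat_minus: "mat (- a) = - mat (a :: 'a::ring_1)"
  by (simp add: vec_eq_iff mat_def)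

lemma mat_mult: "mat (a * b) = mat a ** mat (b :: 'a::semiring_1)"
  by (simp add: vec_eq_iff mat_mult_nth) (simp add: mat_def)

lemma transpose_add: "transpose (X + Y) = transpose X + transpose Y"
  by (simp add: vec_eq_iff transpose_def)

lemma transpose_diff: "transpose (X - Y) = transpose X - transpose Y"
  by (simp add: vec_eq_iff transpose_def)

lemma transpose_minus: "transpose (- X) = - transpose X"
  by (simp add: vec_eq_iff transpose_def)

lemma transpose_zero [simp]: "transpose 0 = 0"
  by (simp add: vec_eq_iff transpose_def)

section \<open>Sylvester equations with disjoint spectra\<close>

text \<open>Horner's scheme with the matrix product \<open>**\<close>. Since \<open>*\<close> on
  matrices is entrywise, \<open>poly\<close> would evaluate something else.\<close>

definition poly_matrix :: "'a::comm_ring_1^'n^'n \<Rightarrow> 'a poly \<Rightarrow> 'a^'n^'n" where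
  "poly_matrix X p = fold_coeffs (\<lambda>a Z. mat a + X ** Z) p 0"

lemma poly_matrix_0 [simp]: "poly_matrix X 0 = 0"
  by (simp add: poly_matrix_def)

lemma poly_matrix_pCons [simp]: "poly_matrix X (pCons a p) = mat a + X ** poly_matrix X p"
  by (cases "a = 0 \<and> p = 0") (auto simp: poly_matrix_def)

lemma poly_matrix_add: "poly_matrix X (p + q) = poly_matrix X p + poly_matrix X q"
  by (induction p q rule: poly_induct2) (auto simp: mat_add matrix_add_ldistrib)

lemma poly_matrix_smult: "poly_matrix X (smult c p) = mat c ** poly_matrix X p"
proof (induction p)
  case (pCons a p)
  have "X ** (mat c ** poly_matrix X p) = mat c ** (X ** poly_matrix X p)"
    by (metis matrix_mul_assoc mat_commute)
  with pCons show ?case by (simp add: mat_mult matrix_add_ldistrib)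
qed simp

lemma poly_matrix_sum: "poly_matrix X (\<Sum>i\<in>I. f i) = (\<Sum>i\<in>I. poly_matrix X (f i))"
  by (induction I rule: infinite_finite_induct) (auto simp: poly_matrix_add)

text \<open>The one case of multiplicativity that is needed: it splits off a root of an annihilating
  polynomial.\<close>

lemma poly_matrix_linear_factor:
  "poly_matrix X ([:- c, 1:] * q) = (X - mat c) ** poly_matrix X q"
proof -
  have eq: "[:- c, 1:] * q = pCons 0 q + smult (- c) q" by simp
  show ?thesis
    unfolding eq poly_matrix_add poly_matrix_smult by (simp add: mat_minus matrix_mult_distribs)
qed

text \<open>There is one more power among \<open>X^0, ..., X^N\<close> than the real dimension
  \<open>N\<close> of the matrix space, so a linear relation holds between them. Any annihilating
  polynomial will do; its degree is irrelevant.\<close>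

lemma exists_annihilating_poly:
  fixes X :: "complex^'n^'n"
  shows "\<exists>p. p \<noteq> 0 \<and> poly_matrix X p = 0"
proof -
  define f where "f k = poly_matrix X (monom 1 k)" for k
  define N where "N = DIM(complex^'n^'n)"
  show ?thesis
  \<comment> \<open>\<open>dependent\<close> speaks of a set and does not see repetitions, so two
    coinciding powers are treated separately, by the difference of their monomials.\<close>
  proof (cases "inj_on f {..N}")
    case False
    then obtain i j where "f i = f j" "i \<noteq> j"
      by (auto simp: inj_on_def)
    then have "poly_matrix X (monom 1 i + smult (- 1) (monom 1 j)) = 0"
      unfolding poly_matrix_add poly_matrix_smult f_def by (simp add: mat_minus matrix_mult_minus_left)
    moreover have "monom (1::complex) i + smult (- 1) (monom 1 j) \<noteq> 0"
    proof
      assume "monom (1::complex) i + smult (- 1) (monom 1 j) = 0"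
      then have "coeff (monom (1::complex) i + smult (- 1) (monom 1 j)) i = 0" by simp
      with \<open>i \<noteq> j\<close> show False by simp
    qed
    ultimately show ?thesis by blast
  next
    case True
    then have "card (f ` {..N}) > DIM(complex^'n^'n)"
      by (simp add: card_image N_def)
    then have "dependent (f ` {..N})"
      by (intro dependent_biggerset) auto
    then obtain u where u: "\<exists>v\<in>f ` {..N}. u v \<noteq> 0" "(\<Sum>v\<in>f ` {..N}. u v *\<^sub>R v) = 0"
      using dependent_finite[of "f ` {..N}"] by auto
    define p where "p = (\<Sum>k\<le>N. smult (complex_of_real (u (f k))) (monom 1 k))"
    have sc: "mat (complex_of_real r) ** Y = r *\<^sub>R Y" for r and Y :: "complex^'n^'n"
      by (simp add: vec_eq_iff mat_mult_nth) (simp add: scaleR_conv_of_real)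
    have "poly_matrix X p = (\<Sum>k\<le>N. u (f k) *\<^sub>R f k)"
      unfolding p_def poly_matrix_sum poly_matrix_smult f_def sc ..
    also have "\<dots> = 0"
      using u(2) True by (simp add: sum.reindex)
    finally have "poly_matrix X p = 0" .
    moreover obtain k where k: "k \<le> N" "u (f k) \<noteq> 0"
      using u(1) by auto
    have "coeff p k = complex_of_real (u (f k))"
      using k(1) by (simp add: p_def coeff_sum if_distrib cong: if_cong)
    with k(2) have "p \<noteq> 0" by auto
    ultimately show ?thesis by blast
  qed
qed

lemma invertible_mult_eq_0_left:
  fixes X :: "'a::field^'n^'n"
  assumes "invertible X" "X ** Y = 0"
  shows "Y = 0"
  using assms by (metis invertible_def matrix_mul_assoc matrix_mul_lid matrix_mult_zero_right)

lemma invertible_mult_eq_0_right: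
  fixes X :: "'a::field^'n^'n"
  assumes "invertible X" "Y ** X = 0"
  shows "Y = 0"
  using assms by (metis invertible_def matrix_mul_assoc matrix_mul_rid matrix_mult_zero_left)

text \<open>The solution space is invariant under left multiplication by \<open>X\<close>, and a solution \<open>Z\<close> with
  \<open>X Z = c Z\<close> also satisfies \<open>Z Y = c Z\<close>, so it vanishes. Hence the linear factors of an
  annihilating polynomial of \<open>X\<close> can be cancelled one at a time.\<close>

lemma sylvester_unique:
  fixes X :: "complex^'n^'n" and Y :: "complex^'m^'m" and Z :: "complex^'m^'n"
  assumes disj: "\<And>z. invertible (mat z - X) \<or> invertible (mat z - Y)"
    and "X ** Z = Z ** Y"
  shows "Z = 0"
proof -
  have cancel: "W = 0" if "X ** W = W ** Y" "(X - mat c) ** W = 0" for c W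
  proof -
    have "(mat c - X) ** W = 0" "W ** (mat c - Y) = 0"
      using that by (simp_all add: matrix_mult_distribs mat_commute)
    with disj[of c] show ?thesis
      using invertible_mult_eq_0_left invertible_mult_eq_0_right by blast
  qed
  have comm: "X ** poly_matrix X p = poly_matrix X p ** X" for p
    by (induction p) (auto simp: matrix_mult_distribs mat_commute matrix_mul_assoc)
  have "p \<noteq> 0 \<Longrightarrow> poly_matrix X p ** Z = 0 \<Longrightarrow> Z = 0" for p
  proof (induction "degree p" arbitrary: p)
    case 0
    then obtain a where a: "p = [:a:]" "a \<noteq> 0"
      by (metis degree_eq_zeroE pCons_0_0)
    with 0 show ?case by (simp add: vec_eq_iff mat_mult_nth)
  next
    case (Suc d)
    then have "\<not> constant (poly p)"
      by (simp add: constant_degree)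
    then obtain c where "poly p c = 0"
      using fundamental_theorem_of_algebra by blast
    then obtain q where q: "p = [:- c, 1:] * q"
      by (auto simp: poly_eq_0_iff_dvd)
    with Suc have "q \<noteq> 0" by auto
    with q Suc.hyps(2) have "d = degree q" by (simp add: degree_mult_eq del: mult_pCons_left)
    have "X ** (poly_matrix X q ** Z) = (poly_matrix X q ** Z) ** Y"
      by (metis assms(2) comm matrix_mul_assoc)
    moreover have "(X - mat c) ** (poly_matrix X q ** Z) = 0"
      using Suc.prems(2) unfolding q poly_matrix_linear_factor by (simp add: matrix_mul_assoc)
    ultimately have "poly_matrix X q ** Z = 0" by (rule cancel)
    with Suc.hyps(1) \<open>d = degree q\<close> \<open>q \<noteq> 0\<close> show ?case by blast
  qed
  moreover obtain p where "p \<noteq> 0" "poly_matrix X p = 0"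
    using exists_annihilating_poly by blast
  ultimately show ?thesis by auto
qed

section \<open>Stable matrices and Lyapunov equations\<close>

abbreviation cmatrix :: "real^'m^'n \<Rightarrow> complex^'m^'n" where
  "cmatrix \<equiv> map_matrix complex_of_real"

lemma cmatrix_mult: "cmatrix (X ** Y) = cmatrix X ** cmatrix Y"
  by (simp add: vec_eq_iff matrix_matrix_mult_def)

lemma stable_iff_invertible:
  "stable X \<longleftrightarrow> (\<forall>z. Re z \<ge> 0 \<longrightarrow> invertible (mat z - cmatrix X))"
  unfolding stable_def spectrum_def subset_iff mem_Collect_eq by (metis linorder_not_le)

lemma invertible_iff_ker:
  fixes X :: "'a::field^'n^'n"
  shows "invertible X \<longleftrightarrow> (\<forall>v. X *v v = 0 \<longrightarrow> v = 0)"
  by (simp add: invertible_left_inverse matrix_left_invertible_ker)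

text \<open>A form free of inverses, suited to norm estimates and to splitting vectors into
  blocks.\<close>

lemma stable_iff_eigenvector:
  "stable X \<longleftrightarrow> (\<forall>z v. Re z \<ge> 0 \<longrightarrow> cmatrix X *v v = z *s v \<longrightarrow> v = 0)"
proof -
  have "(mat z - cmatrix X) *v v = z *s v - cmatrix X *v v" for z v
    by (simp add: matrix_vector_mult_diff_rdistrib)
       (simp add: vec_eq_iff matrix_vector_mult_def mat_def if_distrib if_distribR cong: if_cong)
  then have "(mat z - cmatrix X) *v v = 0 \<longleftrightarrow> cmatrix X *v v = z *s v" for z v
    by auto
  then show ?thesis
    by (simp add: stable_iff_invertible invertible_iff_ker)
qed

lemma stable_transpose:
  assumes "stable X"
  shows "stable (transpose X)"
proof -
  have "mat z - cmatrix (transpose X) = transpose (mat z - cmatrix X)" for z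
    by (auto simp: vec_eq_iff transpose_def mat_def)
  with assms show ?thesis
    by (simp add: stable_iff_invertible invertible_det_nz)
qed

lemma sum_UNIV_Plus:
  "(\<Sum>i\<in>UNIV. f i) = (\<Sum>i\<in>UNIV. f (Inl i)) + (\<Sum>i\<in>UNIV. f (Inr i :: 'a::finite + 'b::finite))"
  using sum.Plus[of UNIV UNIV f] by (simp add: o_def)

text \<open>Each block of an eigenvector satisfies the eigenvector equation of the corresponding
  diagonal block, for the same \<open>z\<close>.\<close>

lemma stable_block_diag:
  assumes "stable X" "stable Y"
  shows "stable (block_diag X Y)"
  unfolding stable_iff_eigenvector
proof (intro allI impI)
  fix z :: complex and v :: "complex^('a + 'b)"
  assume z: "Re z \<ge> 0" and ev: "cmatrix (block_diag X Y) *v v = z *s v"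
  have "cmatrix X *v (\<chi> i. v $ Inl i) = z *s (\<chi> i. v $ Inl i)"
    using ev by (simp add: vec_eq_iff matrix_vector_mult_def sum_UNIV_Plus block_diag_def split_sum_all)
  moreover have "cmatrix Y *v (\<chi> i. v $ Inr i) = z *s (\<chi> i. v $ Inr i)"
    using ev by (simp add: vec_eq_iff matrix_vector_mult_def sum_UNIV_Plus block_diag_def split_sum_all)
  ultimately have "(\<chi> i. v $ Inl i) = 0" "(\<chi> i. v $ Inr i) = 0"
    using assms z by (auto simp: stable_iff_eigenvector)
  then show "v = 0"
    by (simp add: vec_eq_iff split_sum_all)
qed

text \<open>On the closed right half plane \<open>norm (z *s v - cmatrix X *v v)\<close> is bounded
  below by a fixed positive multiple of \<open>norm v\<close>, and a perturbation of smaller norm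
  cannot create an eigenvalue there. This avoids continuity of eigenvalues.\<close>

lemma eventually_stable:
  fixes X Y :: "real^'n^'n"
  assumes "stable X"
  shows "\<forall>\<^sub>F t in nhds 0. stable (X + t *\<^sub>R Y)"
proof -
  have lin: "bounded_linear ((*v) (cmatrix Z))" for Z :: "real^'n^'n"
    by (rule matrix_vector_mul_bounded_linear)
  obtain k where k: "\<And>v. norm (cmatrix X *v v) \<le> norm v * k"
    using bounded_linear.bounded[OF lin] by metis
  obtain l where l: "l > 0" "\<And>v. norm (cmatrix Y *v v) \<le> norm v * l"
    using bounded_linear.pos_bounded[OF lin] by metis
  \<comment> \<open>For \<open>norm z > k + 1\<close> and a unit vector \<open>v\<close>,
    \<open>norm (z *s v)\<close> exceeds \<open>norm (cmatrix X *v v)\<close> by more than 1. Only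
    the remaining \<open>z\<close> need a compactness argument.\<close>
  define K where "K = ({z. Re z \<ge> 0} \<inter> cball (0::complex) (k + 1)) \<times> sphere (0::complex^'n) 1"
  have "compact K"
    unfolding K_def by (intro compact_Times closed_Int_compact closed_halfspace_Re_ge) auto
  define g where "g = (\<lambda>(z::complex, v). norm (z *s v - cmatrix X *v v))"
  have norm_vs: "norm (z *s v) = norm z * norm v" for z and v :: "complex^'n"
    by (simp add: norm_vec_def norm_mult L2_set_right_distrib)
  have "continuous_on K g"
  proof -
    have "continuous_on K (\<lambda>x. fst x *s snd x)"
      unfolding vector_scalar_mult_def by (intro continuous_intros)
    moreover have "continuous_on K (\<lambda>x. cmatrix X *v snd x)"
      unfolding matrix_vector_mult_def by (intro continuous_intros)
    ultimately show ?thesis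
      unfolding g_def case_prod_unfold by (intro continuous_intros)
  qed
  \<comment> \<open>The minimum over \<open>K\<close> is capped at 1 so that the same
    \<open>c\<close> also serves outside the ball.\<close>
  have "\<exists>c>0. c \<le> 1 \<and> (\<forall>x\<in>K. c \<le> g x)"
  proof (cases "K = {}")
    case False
    then obtain x where x: "x \<in> K" "\<And>y. y \<in> K \<Longrightarrow> g x \<le> g y"
      using continuous_attains_inf[OF \<open>compact K\<close> _ \<open>continuous_on K g\<close>] by blast
    obtain z v where zv: "x = (z, v)" by force
    with x(1) have "Re z \<ge> 0" "v \<noteq> 0" by (auto simp: K_def)
    with assms have "cmatrix X *v v \<noteq> z *s v" unfolding stable_iff_eigenvector by blast
    then have "g x > 0" by (simp add: g_def zv)
    moreover have "\<forall>y\<in>K. min 1 (g x) \<le> g y" using x(2) by (simp add: min.coboundedI2)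
    ultimately show ?thesis by (intro exI[of _ "min 1 (g x)"]) simp
  next
    case True
    then show ?thesis by (intro exI[of _ 1]) simp
  qed
  then obtain c where c: "0 < c" "c \<le> 1" "\<And>x. x \<in> K \<Longrightarrow> c \<le> g x" by blast
  have lower: "c * norm v \<le> norm (z *s v - cmatrix X *v v)" if "Re z \<ge> 0" for z v
  proof (cases "v = 0")
    case False
    define w where "w = inverse (norm v) *\<^sub>R v"
    have w: "norm w = 1" "v = norm v *\<^sub>R w"
      using False by (simp_all add: w_def)
    have "c \<le> norm (z *s w - cmatrix X *v w)"
    proof (cases "norm z \<le> k + 1")
      case True
      then have "(z, w) \<in> K" using that w by (simp add: K_def)
      with c(3) show ?thesis by (force simp: g_def)
    next
      case False
      have "norm (z *s w) - norm (cmatrix X *v w) \<le> norm (z *s w - cmatrix X *v w)"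
        by (rule norm_triangle_ineq2)
      with k[of w] False w c(2) show ?thesis by (simp add: norm_vs)
    qed
    moreover have "z *s v - cmatrix X *v v = norm v *\<^sub>R (z *s w - cmatrix X *v w)"
      by (subst (1 2) w(2)) (simp add: vec_eq_iff matrix_vector_mult_def algebra_simps scaleR_sum_right)
    ultimately show ?thesis
      by (simp add: mult.commute[of c] mult_left_mono)
  qed simp
  \<comment> \<open>The threshold \<open>c / l\<close> makes the perturbation of \<open>v\<close>
    strictly shorter than \<open>c * norm v\<close> unless \<open>v = 0\<close>.\<close>
  have "stable (X + t *\<^sub>R Y)" if t: "\<bar>t\<bar> < c / l" for t
    unfolding stable_iff_eigenvector
  proof (intro allI impI)
    fix z v assume z: "Re z \<ge> 0" and ev: "cmatrix (X + t *\<^sub>R Y) *v v = z *s v"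
    have "cmatrix (X + t *\<^sub>R Y) *v v = cmatrix X *v v + t *\<^sub>R (cmatrix Y *v v)"
      by (simp add: vec_eq_iff matrix_vector_mult_def scaleR_conv_of_real[where 'a = complex]
          sum_distrib_left sum.distrib[symmetric] distrib_right mult.assoc)
    then have "z *s v - cmatrix X *v v = t *\<^sub>R (cmatrix Y *v v)"
      using ev by (simp add: algebra_simps)
    then have "c * norm v \<le> \<bar>t\<bar> * norm (cmatrix Y *v v)"
      using lower[OF z, of v] by simp
    also have "\<dots> \<le> \<bar>t\<bar> * (norm v * l)"
      by (intro mult_left_mono l) auto
    finally have "c * norm v \<le> \<bar>t\<bar> * l * norm v"
      by (simp add: mult_ac)
    moreover have "\<bar>t\<bar> * l < c" using t l(1) by (simp add: field_simps)
    ultimately show "v = 0"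
      using mult_strict_right_mono[of "\<bar>t\<bar> * l" c "norm v"]
      by (metis linorder_not_less zero_less_norm_iff)
  qed
  moreover have "c / l > 0" using c l by simp
  ultimately show ?thesis
    unfolding eventually_nhds_metric by (auto simp: dist_real_def)
qed

text \<open>The operator of the equation for \<open>M\<close>. Taken at \<open>transpose F\<close>
  it is the adjoint operator, which governs \<open>W\<close>, so one theory covers both Lyapunov
  equations.\<close>

definition lyap :: "real^'n^'n \<Rightarrow> real^'n^'n \<Rightarrow> real^'n^'n" where
  "lyap F X = transpose F ** X + X ** F"

lemma linear_lyap: "linear (lyap F)"
  by (rule linearI) (simp_all add: lyap_def matrix_mult_distribs algebra_simps)

lemma lyap_add_scaleR: "lyap (F + t *\<^sub>R E) X = lyap F X + t *\<^sub>R lyap E X"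
  by (simp add: lyap_def matrix_mult_distribs transpose_add transpose_scalar algebra_simps)

lemma transpose_lyap: "transpose (lyap F X) = lyap F (transpose X)"
  by (simp add: lyap_def transpose_add matrix_transpose_mul add.commute)

text \<open>A kernel element intertwines \<open>transpose F\<close> and \<open>- F\<close>, whose
  spectra lie in the open left and the open right half plane, so \<open>sylvester_unique\<close>
  applies.\<close>

lemma inj_lyap:
  assumes "stable F"
  shows "inj (lyap F)"
  unfolding linear_injective_0[OF linear_lyap]
proof (intro allI impI)
  fix X assume "lyap F X = 0"
  then have "transpose F ** X = X ** (- F)"
    by (simp add: lyap_def matrix_mult_minus_right add_eq_0_iff2)
  then have "cmatrix (transpose F) ** cmatrix X = cmatrix X ** cmatrix (- F)"
    by (metis cmatrix_mult)
  moreover have "invertible (mat z - cmatrix (transpose F)) \<or> invertible (mat z - cmatrix (- F))" for z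
  proof (cases "Re z \<ge> 0")
    case True
    then show ?thesis
      using stable_transpose[OF assms] by (simp add: stable_iff_invertible)
  next
    case False
    have "(mat z - cmatrix (- F)) *v v = - ((mat (- z) - cmatrix F) *v v)" for v
      by (simp add: vec_eq_iff matrix_vector_mult_def mat_minus sum_negf[symmetric] algebra_simps)
    moreover have "invertible (mat (- z) - cmatrix F)"
      using False assms by (simp add: stable_iff_invertible)
    ultimately show ?thesis
      by (simp add: invertible_iff_ker)
  qed
  ultimately have "cmatrix X = 0"
    using sylvester_unique by blast
  then show "X = 0"
    by (simp add: vec_eq_iff)
qed

text \<open>An injective linear endomorphism in finite dimension is onto. The transpose of a
  solution solves the same equation, so uniqueness makes the solution symmetric.\<close>

lemma lyap_solvable:
  assumes "stable F" "transpose Q = Q"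
  shows "\<exists>X. transpose X = X \<and> lyap F X = Q"
proof -
  obtain X where X: "lyap F X = Q"
    using linear_inj_imp_surj[OF linear_lyap inj_lyap[OF assms(1)]] by (metis surjD)
  then have "lyap F (transpose X) = lyap F X"
    using assms(2) by (metis transpose_lyap)
  with X inj_lyap[OF assms(1)] show ?thesis
    by (auto dest: injD)
qed

section \<open>Perturbation of linear equations\<close>

text \<open>\<open>T\<close> is bounded below and \<open>T (x t - x0) = - t K (x t)\<close>, so the
  error is of order \<open>t\<close>. No regularity of \<open>x\<close> in \<open>t\<close> is
  assumed, so the solutions may be chosen pointwise.\<close>

lemma tendsto_perturbed_linear_solution:
  fixes T K :: "'a::euclidean_space \<Rightarrow> 'b::euclidean_space"
  assumes "linear T" "inj T" "linear K"
    and sol: "\<forall>\<^sub>F t in at 0. T (x t) + t *\<^sub>R K (x t) = T x0"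
  shows "(x \<longlongrightarrow> x0) (at (0::real))"
proof -
  obtain b where b: "b > 0" "\<And>y. b * norm y \<le> norm (T y)"
    using linear_inj_bounded_below_pos[OF assms(1,2)] by metis
  obtain k where k: "k > 0" "\<And>y. norm (K y) \<le> k * norm y"
    using linear_bounded_pos[OF assms(3)] by metis
  \<comment> \<open>With \<open>b / 2\<close> the error term on the right can be absorbed, leaving
    half of the left side.\<close>
  have small: "\<forall>\<^sub>F t in at 0. \<bar>t\<bar> * k < b / 2"
  proof (rule order_tendstoD)
    show "((\<lambda>t. \<bar>t\<bar> * k) \<longlongrightarrow> \<bar>0\<bar> * k) (at 0)" by (intro tendsto_intros)
    show "\<bar>0\<bar> * k < b / 2" using b by simp
  qed
  have "\<forall>\<^sub>F t in at 0. norm (x t - x0) \<le> \<bar>t\<bar> * (2 * k * norm x0 / b)"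
    using sol small
  proof eventually_elim
    case (elim t)
    have "T (x t - x0) = - (t *\<^sub>R K (x t))"
      using elim(1) by (simp add: linear_diff[OF assms(1)] algebra_simps)
    then have "b * norm (x t - x0) \<le> \<bar>t\<bar> * norm (K (x t))"
      using b(2)[of "x t - x0"] by simp
    also have "\<dots> \<le> \<bar>t\<bar> * (k * norm (x t))"
      by (intro mult_left_mono k) auto
    also have "\<dots> \<le> \<bar>t\<bar> * (k * (norm (x t - x0) + norm x0))"
      using k norm_triangle_sub[of "x t" x0] by (intro mult_left_mono) (auto simp: add.commute)
    also have "\<dots> = (\<bar>t\<bar> * k) * norm (x t - x0) + \<bar>t\<bar> * k * norm x0"
      by (simp add: algebra_simps)
    also have "\<dots> \<le> (b / 2) * norm (x t - x0) + \<bar>t\<bar> * k * norm x0"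
      using elim(2) by (intro add_right_mono mult_right_mono) auto
    finally have "(b / 2) * norm (x t - x0) \<le> \<bar>t\<bar> * k * norm x0"
      by (simp add: field_simps)
    with b(1) show ?case by (simp add: field_simps)
  qed
  moreover have "((\<lambda>t. \<bar>t\<bar> * (2 * k * norm x0 / b)) \<longlongrightarrow> \<bar>0\<bar> * (2 * k * norm x0 / b)) (at 0)"
    by (intro tendsto_intros)
  ultimately have "((\<lambda>t. x t - x0) \<longlongrightarrow> 0) (at 0)"
    by (intro Lim_null_comparison[of "\<lambda>t. x t - x0"]) auto
  then show ?thesis
    by (simp add: LIM_zero_iff)
qed

text \<open>Fermat's rule with \<open>g\<close> as difference quotient: \<open>g\<close> is
  nonpositive to the left of 0 and nonnegative to the right, and the limit inherits both
  signs.\<close>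

lemma tendsto_eq_0_if_nonneg_multiple:
  fixes g :: "real \<Rightarrow> real"
  assumes lim: "(g \<longlongrightarrow> l) (at 0)" and nonneg: "\<forall>\<^sub>F t in at 0. 0 \<le> t * g t"
  shows "l = 0"
proof (rule antisym)
  have "\<forall>\<^sub>F t in at_left 0. g t \<le> 0"
    using nonneg unfolding eventually_at_split eventually_at_filter
    by (auto elim!: eventually_mono simp: zero_le_mult_iff)
  then show "l \<le> 0"
    using lim by (intro tendsto_upperbound[of g l "at_left 0"]) (auto simp: filterlim_at_split)
  have "\<forall>\<^sub>F t in at_right 0. 0 \<le> g t"
    using nonneg unfolding eventually_at_split eventually_at_filter
    by (auto elim!: eventually_mono simp: zero_le_mult_iff)
  then show "0 \<le> l"
    using lim by (intro tendsto_lowerbound[of g l "at_right 0"]) (auto simp: filterlim_at_split)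
qed

section \<open>Traces\<close>

lemma trace_scaleR: "trace (r *\<^sub>R X) = r * trace X" for X :: "real^'n^'n"
  by (simp add: trace_def sum_distrib_left)

lemma trace_minus: "trace (- X) = - trace X" for X :: "real^'n^'n"
  by (simp add: trace_def sum_negf)

lemma trace_transpose: "trace (transpose X) = trace X"
  by (simp add: trace_def transpose_def)

text \<open>The trace is the sum of the squares of all entries, the squared Frobenius norm.\<close>

lemma trace_mult_transpose_eq_0_iff:
  fixes X :: "real^'m^'n"
  shows "trace (X ** transpose X) = 0 \<longleftrightarrow> X = 0"
  by (auto simp: trace_def matrix_matrix_mult_def transpose_def vec_eq_iff sum_nonneg
      sum_nonneg_eq_0_iff)

lemma tendsto_trace_mult:
  fixes N :: "'a \<Rightarrow> real^'n^'n"
  assumes "(N \<longlongrightarrow> M) \<F>"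
  shows "((\<lambda>t. trace (N t ** X)) \<longlongrightarrow> trace (M ** X)) \<F>"
proof -
  have "linear (\<lambda>Y::real^'n^'n. trace (Y ** X))"
    by (rule linearI) (simp_all add: matrix_mult_distribs trace_add trace_scaleR)
  then show ?thesis
    using assms unfolding linear_conv_bounded_linear by (rule bounded_linear.tendsto)
qed

section \<open>Variation of the cost\<close>

text \<open>Pairing \<open>lyap F (N - M) = - t lyap E N\<close> with the adjoint state \<open>W\<close> eliminates \<open>N - M\<close>, so the
  limit of the difference quotient needs only \<open>N \<longlongrightarrow> M\<close>, not a derivative of \<open>N\<close>.\<close>

lemma trace_cost_difference:
  fixes F E M N W :: "real^'n^'n" and b h :: "real^'m^'n"
  assumes "lyap (F + t *\<^sub>R E) N = lyap F M"
    and W: "lyap (transpose F) W = - (b ** transpose b)"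
    and sym: "transpose N = N" "transpose W = W"
  shows "trace (N ** ((b + t *\<^sub>R h) ** transpose (b + t *\<^sub>R h))) - trace (M ** (b ** transpose b))
    = t * (2 * trace (N ** (h ** transpose b)) + t * trace (N ** (h ** transpose h))
        + 2 * trace (N ** (E ** W)))"
proof -
  define D where "D = N - M"
  have "lyap F D = - (t *\<^sub>R lyap E N)"
    using assms(1) by (simp add: D_def linear_diff[OF linear_lyap] lyap_add_scaleR algebra_simps)
  moreover have "trace (D ** (b ** transpose b)) = - trace (lyap F D ** W)"
  proof -
    have "b ** transpose b = - lyap (transpose F) W" using W by simp
    moreover have "trace (D ** (W ** transpose F)) = trace (transpose F ** D ** W)"
      by (metis matrix_mul_assoc trace_mul_sym)
    ultimately show ?thesis
      by (simp add: lyap_def matrix_mult_distribs trace_add trace_minus trace_sub matrix_mul_assoc)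
  qed
  moreover have "trace (lyap E N ** W) = 2 * trace (N ** (E ** W))"
  proof -
    \<comment> \<open>By symmetry of \<open>N\<close> and \<open>W\<close>, transposition and a
      cyclic shift turn the first summand of \<open>lyap E N\<close>, paired with \<open>W\<close>,
      into the second. Hence the factor 2.\<close>
    have "trace (transpose E ** N ** W) = trace (transpose (transpose E ** N ** W))"
      by (simp add: trace_transpose)
    also have "\<dots> = trace (W ** (N ** E))"
      by (simp add: matrix_transpose_mul sym)
    also have "\<dots> = trace (N ** (E ** W))"
      by (metis matrix_mul_assoc trace_mul_sym)
    finally show ?thesis
      by (simp add: lyap_def matrix_mult_distribs trace_add matrix_mul_assoc)
  qed
  ultimately have D: "trace (D ** (b ** transpose b)) = t * (2 * trace (N ** (E ** W)))"
    by (simp add: matrix_mult_distribs trace_minus trace_scaleR)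
  have "trace (N ** (b ** transpose h)) = trace (transpose (N ** (b ** transpose h)))"
    by (simp add: trace_transpose)
  also have "\<dots> = trace (N ** (h ** transpose b))"
    by (simp add: matrix_transpose_mul sym) (metis trace_mul_sym)
  finally have bh: "trace (N ** (b ** transpose h)) = trace (N ** (h ** transpose b))" .
  have "trace (N ** (b ** transpose b)) = trace (D ** (b ** transpose b)) + trace (M ** (b ** transpose b))"
    by (simp add: D_def matrix_mult_distribs trace_sub)
  with D bh show ?thesis
    by (simp add: transpose_add transpose_scalar matrix_mult_distribs trace_add trace_scaleR algebra_simps)
qed

section \<open>Block matrices\<close>

lemma vstack_mult: "vstack P Q ** X = vstack (P ** X) (Q ** X)"
  by (simp add: vec_eq_iff vstack_def matrix_matrix_mult_def split_sum_all)

lemma hstack_mult_vstack: "hstack P Q ** vstack X Y = P ** X + Q ** Y"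
  by (simp add: vec_eq_iff vstack_def hstack_def matrix_matrix_mult_def sum_UNIV_Plus)

lemma transpose_vstack: "transpose (vstack P Q) = hstack (transpose P) (transpose Q)"
  by (simp add: vec_eq_iff vstack_def hstack_def transpose_def split_sum_all)

lemma transpose_hstack: "transpose (hstack P Q) = vstack (transpose P) (transpose Q)"
  by (simp add: vec_eq_iff vstack_def hstack_def transpose_def split_sum_all)

lemma vstack_add: "vstack (P + P') (Q + Q') = vstack P Q + vstack P' Q'"
  by (simp add: vec_eq_iff vstack_def split_sum_all)

lemma vstack_scaleR: "vstack (r *\<^sub>R P) (r *\<^sub>R Q) = r *\<^sub>R vstack P Q"
  by (simp add: vec_eq_iff vstack_def split_sum_all)

lemma mult_hstack: "X ** hstack P Q = hstack (X ** P) (X ** Q)"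
  by (simp add: vec_eq_iff hstack_def matrix_matrix_mult_def split_sum_all)

text \<open>The injection \<open>J\<close> of the second block: \<open>J ** R ** transpose J\<close>
  has \<open>R\<close> as its lower right block and zeros elsewhere, and \<open>X ** J\<close> is
  the second block column of \<open>X\<close>.\<close>

definition embed2 :: "real^'v^('n::finite + 'v::finite)" where
  "embed2 = vstack 0 (mat 1)"

lemma embed2_mult: "embed2 ** X = vstack 0 X"
  by (simp add: embed2_def vstack_mult)

lemma mult_embed2: "X ** embed2 = vstack (block12 X) (block22 X)"
  by (simp add: vec_eq_iff vstack_def embed2_def block12_def block22_def matrix_matrix_mult_def
      sum_UNIV_Plus split_sum_all mat_def if_distrib if_distribR cong: if_cong)

text \<open>Makes the dependence of \<open>error_A\<close> on \<open>G\<close> affine in a form that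
  needs no further block computations.\<close>

lemma block_diag_add_embed2:
  "block_diag P (Q + R) = block_diag P Q + embed2 ** R ** transpose embed2"
proof -
  have eq: "embed2 ** R ** transpose embed2 = vstack (hstack 0 0) (hstack 0 R)"
    unfolding embed2_mult unfolding embed2_def transpose_vstack vstack_mult by (simp add: mult_hstack)
  show ?thesis
    unfolding eq by (simp add: vec_eq_iff block_diag_def vstack_def hstack_def split_sum_all)
qed

lemma transpose_error_C: "transpose (error_C C P) = error_C C P"
  by (simp add: error_C_def matrix_transpose_mul transpose_vstack transpose_hstack transpose_minus
      matrix_mul_assoc)

lemma transpose_error_B: "transpose (error_B B G) = error_B B G"
  by (simp add: error_B_def matrix_transpose_mul)

section \<open>Stationarity at a minimizer\<close>

theorem lemma3p8:
  fixes A :: "real^'n^'n" and B :: "real^'m^'n" and C :: "real^'n^'p"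
    and S :: "real^'v^'v" and L :: "real^'v^'m" and P :: "real^'v^'n"
    and G :: "real^'m^'v" and M :: "real^('n::finite + 'v::finite)^('n + 'v)"
  assumes "minimal_realization A B C"
    and "stable A"
    and "observable_pair L S"
    and "spectrum S \<inter> spectrum A = {}"
    and "A ** P + B ** L = P ** S"
    and "is_arg_min (\<lambda>(G, M). trace (M ** error_B B G)) (feasible A C S L P) (G, M)"
  shows "\<exists>W :: real^('n::finite + 'v::finite)^('n + 'v). transpose W = W \<and>
     transpose (error_A A S L G) ** M + M ** error_A A S L G + error_C C P = 0 \<and>
     error_A A S L G ** W + W ** transpose (error_A A S L G) + error_B B G = 0 \<and>
     transpose (block12 M) ** B + block22 M ** G
       - transpose (block12 M) ** block12 W ** transpose L
       - block22 M ** block22 W ** transpose L = 0"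
proof -
  define F where "F = error_A A S L G"
  define b where "b = vstack B G"
  define J :: "real^'v^('n + 'v)" where "J = embed2"
  have feas: "feasible A C S L P (G, M)"
    and opt: "\<And>G' M'. feasible A C S L P (G', M') \<Longrightarrow>
      trace (M ** error_B B G) \<le> trace (M' ** error_B B G')"
    using assms(6) by (auto simp: is_arg_min_def not_less)
  from feas have M: "transpose M = M" "lyap F M = - error_C C P" and stab: "stable (S - G ** L)"
    by (auto simp: feasible_def lyap_def F_def add_eq_0_iff2)
  have "stable F"
    unfolding F_def error_A_def using assms(2) stab by (rule stable_block_diag)
  then obtain W where W: "transpose W = W" "lyap (transpose F) W = - error_B B G"
    using lyap_solvable[of "transpose F" "- error_B B G"]
    by (auto simp: stable_transpose transpose_minus transpose_error_B)
  \<comment> \<open>The third KKT residual: \<open>transpose J ** M\<close> is the second block row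
    of \<open>M\<close> and \<open>W ** J\<close> the second block column of
    \<open>W\<close>.\<close>
  define Z where "Z = transpose J ** M ** b - transpose J ** M ** W ** J ** transpose L"
  \<comment> \<open>\<open>E\<close> and \<open>h\<close> are the derivatives of
    \<open>error_A\<close> and of \<open>vstack B G\<close> in the direction \<open>Z\<close>; both
    maps are affine in \<open>G\<close>, so \<open>A_eq\<close> and \<open>B_eq\<close> are
    exact.\<close>
  define E where "E = - (J ** (Z ** L) ** transpose J)"
  define h where "h = J ** Z"
  have A_eq: "error_A A S L (G + t *\<^sub>R Z) = F + t *\<^sub>R E" for t
  proof -
    have "S - (G + t *\<^sub>R Z) ** L = (S - G ** L) + (- t) *\<^sub>R (Z ** L)"
      by (simp add: matrix_mult_distribs)
    then show ?thesis
      unfolding error_A_def F_def E_def J_def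
      by (simp only: block_diag_add_embed2) (simp add: matrix_mult_distribs)
  qed
  have B_eq: "vstack B (G + t *\<^sub>R Z) = b + t *\<^sub>R h" for t
    unfolding b_def h_def J_def embed2_mult
    by (simp add: vstack_add[symmetric] vstack_scaleR[symmetric])
  \<comment> \<open>For \<open>t\<close> far from 0 a solution may fail to exist and
    \<open>N t\<close> is arbitrary; only \<open>t\<close> near 0 enters.\<close>
  define N where "N t = (SOME X. transpose X = X \<and> lyap (F + t *\<^sub>R E) X = - error_C C P)" for t
  have "\<forall>\<^sub>F t in at 0. stable (S - G ** L + t *\<^sub>R (- (Z ** L)))"
    using eventually_stable[OF stab, of "- (Z ** L)"] unfolding eventually_at_filter
    by (rule eventually_mono) simp
  then have N: "\<forall>\<^sub>F t in at 0. feasible A C S L P (G + t *\<^sub>R Z, N t)"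
  proof eventually_elim
    case (elim t)
    then have st: "stable (S - (G + t *\<^sub>R Z) ** L)"
      by (simp add: matrix_mult_distribs algebra_simps)
    then have "stable (F + t *\<^sub>R E)"
      unfolding A_eq[symmetric] error_A_def using assms(2) by (intro stable_block_diag)
    then have "\<exists>X. transpose X = X \<and> lyap (F + t *\<^sub>R E) X = - error_C C P"
      by (intro lyap_solvable) (simp_all add: transpose_minus transpose_error_C)
    then have "transpose (N t) = N t \<and> lyap (F + t *\<^sub>R E) (N t) = - error_C C P"
      unfolding N_def by (rule someI_ex)
    with st show ?case
      by (simp add: feasible_def A_eq lyap_def)
  qed
  have N_lyap: "lyap (F + t *\<^sub>R E) (N t) = lyap F M" "transpose (N t) = N t"
    if "feasible A C S L P (G + t *\<^sub>R Z, N t)" for t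
    using that M by (auto simp: feasible_def A_eq lyap_def add_eq_0_iff2)
  \<comment> \<open>The right-hand side \<open>- error_C C P\<close> does not depend on
    \<open>t\<close>, so \<open>N t\<close> solves a perturbation of the equation for
    \<open>M\<close> with the same right-hand side.\<close>
  have "(N \<longlongrightarrow> M) (at 0)"
    by (rule tendsto_perturbed_linear_solution[OF linear_lyap inj_lyap[OF \<open>stable F\<close>] linear_lyap[of E]])
      (use N in \<open>eventually_elim, use N_lyap in \<open>simp add: lyap_add_scaleR\<close>\<close>)
  define g where "g t = 2 * trace (N t ** (h ** transpose b)) + t * trace (N t ** (h ** transpose h))
      + 2 * trace (N t ** (E ** W))" for t
  have "(g \<longlongrightarrow> 2 * trace (M ** (h ** transpose b)) + 0 * trace (M ** (h ** transpose h))
      + 2 * trace (M ** (E ** W))) (at 0)"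
    unfolding g_def by (intro tendsto_intros tendsto_trace_mult \<open>(N \<longlongrightarrow> M) (at 0)\<close>)
  moreover have "\<forall>\<^sub>F t in at 0. 0 \<le> t * g t"
    using N
  proof eventually_elim
    case (elim t)
    have "t * g t = trace (N t ** error_B B (G + t *\<^sub>R Z)) - trace (M ** error_B B G)"
      unfolding g_def error_B_def B_eq b_def[symmetric]
      using N_lyap[OF elim] W
      by (intro trace_cost_difference[symmetric]) (auto simp: error_B_def b_def)
    with opt[OF elim] show ?case by simp
  qed
  ultimately have "2 * trace (M ** (h ** transpose b)) + 0 * trace (M ** (h ** transpose h))
      + 2 * trace (M ** (E ** W)) = 0"
    by (rule tendsto_eq_0_if_nonneg_multiple)
  then have "trace (M ** (h ** transpose b)) + trace (M ** (E ** W)) = 0"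
    by simp
  \<comment> \<open>Cyclic shifts bring \<open>Z\<close> to the front of both terms; the remaining
    factors then combine to \<open>transpose Z\<close>.\<close>
  moreover have "trace (M ** (h ** transpose b)) = trace (Z ** (transpose b ** M ** J))"
  proof -
    have "M ** (h ** transpose b) = (M ** J) ** (Z ** transpose b)"
      by (simp add: h_def matrix_mul_assoc)
    then show ?thesis
      by (metis trace_mul_sym matrix_mul_assoc)
  qed
  moreover have "trace (M ** (E ** W)) = - trace (Z ** (L ** transpose J ** W ** M ** J))"
  proof -
    have "M ** (E ** W) = - ((M ** J) ** (Z ** (L ** transpose J ** W)))"
      by (simp add: E_def matrix_mult_distribs matrix_mul_assoc)
    then show ?thesis
      by (metis trace_minus trace_mul_sym matrix_mul_assoc)
  qed
  moreover have "transpose Z = transpose b ** M ** J - L ** transpose J ** W ** M ** J"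
    by (simp add: Z_def transpose_diff matrix_transpose_mul M(1) W(1) matrix_mul_assoc)
  ultimately have "trace (Z ** transpose Z) = 0"
    by (simp add: matrix_mult_diff_right trace_sub)
  then have "Z = 0"
    by (simp add: trace_mult_transpose_eq_0_iff)
  moreover have JM: "transpose J ** M = hstack (transpose (block12 M)) (block22 M)"
  proof -
    have "transpose J ** M = transpose (M ** J)"
      by (simp add: matrix_transpose_mul M(1))
    also have "\<dots> = hstack (transpose (block12 M)) (transpose (block22 M))"
      by (simp add: J_def mult_embed2 transpose_vstack)
    also have "transpose (block22 M) = block22 M"
      using M(1) by (simp add: vec_eq_iff block22_def transpose_def)
    finally show ?thesis .
  qed
  moreover have "transpose J ** M ** W ** J = (transpose J ** M) ** (W ** J)"
    by (simp add: matrix_mul_assoc)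
  ultimately have "transpose (block12 M) ** B + block22 M ** G
       - (transpose (block12 M) ** block12 W + block22 M ** block22 W) ** transpose L = 0"
    by (simp add: Z_def b_def hstack_mult_vstack) (simp add: J_def mult_embed2 hstack_mult_vstack)
  with W M show ?thesis
    unfolding lyap_def F_def by (intro exI[of _ W]) (simp add: matrix_mult_add_left diff_diff_eq)
qed

end
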